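(* Let $p\in\mathcal{B}$, let $k$ be a positive integer and let $n_k\ge 2$ be an integer such that $p^k\mid\frac{D_{n_k}}{n_k-1}$. Define $\widehat{q}_p(n_k)=\frac{1}{p}\left(\frac{D_{n_k+p}}{n_k+p-1}+\frac{D_{n_k}}{n_k-1}\right)$. (1) If $p\nmid\widehat{q}_p(n_k)$, then there exists a unique $n_{k+1}$ modulo $p^{k+1}$ such that $n_{k+1}\equiv n_k\pmod{p^k}$ and $p^{k+1}\mid\frac{D_n}{n-1}$ for all $n\ge2$ congruent to $n_{k+1}$ modulo $p^{k+1}$. Moreover, $n_{k+1}\equiv n_k+\frac{D_{n_k}}{(n_k-1)\widehat{q}_p(n_k)}\pmod{p^{k+1}}$. (2) If $p\mid\widehat{q}_p(n_k)$ and $p^{k+1}\mid\frac{D_{n_k}}{n_k-1}$, then $p^{k+1}\mid\frac{D_n}{n-1}$ for all $n$ satisfying $n\equiv n_k\pmod{p^k}$ and $n\ge2$. (3) If $p\mid\widehat{q}_p(n_k)$ and $p^{k+1}\nmid\frac{D_{n_k}}{n_k-1}$, then $p^{k+1}\nmid\frac{D_n}{n-1}$ for any $n$ satisfying $n\equiv n_k\pmod{p^k}$ and $n\ge2$. In particular, if $k=1$, $p\mid\frac{D_{n_1}}{n_1-1}$ and $p^2\nmid\left(\frac{D_{n_1+p}}{n_1+p-1}+\frac{D_{n_1}}{n_1-1}\right)$, then for any positive integer $l$ there exists a unique $n_l$ modulo $p^l$ such that $n_l\equiv n_1\pmod p$ and $v_p\left(\frac{D_n}{n-1}\right)\ge l$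 for all $n\ge2$ congruent to $n_l$ modulo $p^l$. Moreover, for $l>1$ (with representative $n_{l-1}\geq 2$), $n_l$ satisfies $n_l\equiv n_{l-1}+\frac{D_{n_{l-1}}}{(n_{l-1}-1)\widehat{q}_p(n_1)}\pmod{p^l}$.
   Context: $(D_n)_{n\ge0}$ is the sequence of numbers of derangements: $D_0=1$, $D_n=nD_{n-1}+(-1)^n$ for $n>0$; one has $n-1\mid D_n$ for all $n\ge 0$. $v_p$ is the $p$-adic valuation with $v_p(0)=+\infty$; for rational numbers $x\equiv y\pmod{p^j}$ means $v_p(x-y)\ge j$. $\mathcal{A}$ is the set of all primes $p$ such that $v_p(n-1)=v_p(D_n)$ for all integers $n\ge0$, and $\mathcal{B}$ is the set of all primes not in $\mathcal{A}$.
   Formalization: The last formula for n_l fails for representatives n_{l-1} of parity opposite to n_1 (p=3, n_1=4, n_{l-1}=7, l=2); it is stated as given when n_{l-1} and n_1 have the same parity, and with a minus sign before the fraction otherwise. *)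

theory Defs
  imports "HOL-Number_Theory.Number_Theory" "HOL-Library.Extended"
begin

primrec derangements :: "nat \<Rightarrow> int" where
  "derangements 0 = 1"
| "derangements (Suc n) = int (Suc n) * derangements n + (-1) ^ Suc n"

text \<open>The value \<open>Pinf\<close> of the valuation at \<open>0\<close> is needed because
  \<open>multiplicity p 0 = 0\<close> in the library.\<close>

definition pval :: "nat \<Rightarrow> rat \<Rightarrow> int extended" where
  "pval p x =
     (if x = 0 then Pinf
      else let (a, b) = quotient_of x
           in Fin (int (multiplicity (int p) a) - int (multiplicity (int p) b)))"

definition rat_cong :: "nat \<Rightarrow> nat \<Rightarrow> rat \<Rightarrow> rat \<Rightarrow> bool" where
  "rat_cong p j x y \<longleftrightarrow> pval p (x - y) \<ge> Fin (int j)"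

definition primes_A :: "nat set" where
  "primes_A =
     {p. prime p \<and> (\<forall>n::nat. pval p (of_nat n - 1) = pval p (of_int (derangements n)))}"

definition primes_B :: "nat set" where
  "primes_B = {p. prime p \<and> p \<notin> primes_A}"

definition dquot :: "nat \<Rightarrow> rat" where
  "dquot n = of_int (derangements n) / (of_nat n - 1)"

definition qhat :: "nat \<Rightarrow> nat \<Rightarrow> rat" where
  "qhat p n = 1 / of_nat p * (dquot (n + p) + dquot n)"

text \<open>Divisibility in the integers for a quotient formed in the rationals. The relation
  \<open>dvd\<close> on type \<open>rat\<close> would be divisibility in a field. The lemmas \<open>dquot_in_Ints\<close> and
  \<open>qhat_in_Ints\<close> below show that the numbers to which \<open>zdvd\<close> is applied are integers.\<close>

definition zdvd :: "nat \<Rightarrow> rat \<Rightarrow> bool" where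
  "zdvd m x \<longleftrightarrow> (\<exists>z::int. x = of_int z \<and> int m dvd z)"

text \<open>Residue classes are represented by arbitrary integers \<open>a\<close>.\<close>

definition ex1_mod :: "nat \<Rightarrow> (int \<Rightarrow> bool) \<Rightarrow> bool" where
  "ex1_mod M P \<longleftrightarrow> (\<exists>a. P a) \<and> (\<forall>a b. P a \<longrightarrow> P b \<longrightarrow> [a = b] (mod int M))"

definition lift_dvd :: "nat \<Rightarrow> nat \<Rightarrow> nat \<Rightarrow> int \<Rightarrow> bool" where
  "lift_dvd p k m a \<longleftrightarrow>
     [a = int m] (mod int (p ^ k)) \<and>
     (\<forall>n::nat. n \<ge> 2 \<longrightarrow> [int n = a] (mod int (p ^ (k + 1))) \<longrightarrow> zdvd (p ^ (k + 1)) (dquot n))"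

text \<open>The congruence expressing a lift modulo \<open>p ^ l\<close> through \<open>qhat p n1\<close>, for a fixed \<open>n1\<close>,
  depends on the parity of the representative \<open>m\<close> that is lifted: \<open>qhat p m\<close> is congruent to
  \<open>(-1) ^ (m + n1) * qhat p n1\<close> modulo \<open>p\<close>. For example, with \<open>p = 11\<close>, \<open>n1 = 5\<close>, \<open>l = 2\<close> the
  formula without a sign gives the right class for \<open>m = 5\<close> but not for \<open>m = 16\<close>.\<close>

definition lift_val :: "nat \<Rightarrow> nat \<Rightarrow> nat \<Rightarrow> int \<Rightarrow> bool" where
  "lift_val p m l a \<longleftrightarrow>
     [a = int m] (mod int p) \<and>
     (\<forall>n::nat. n \<ge> 2 \<longrightarrow> [int n = a] (mod int (p ^ l)) \<longrightarrow> pval p (dquot n) \<ge> Fin (int l))"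

lemma derangements_Suc_Suc:
  "derangements (Suc (Suc n)) = int (Suc n) * (derangements (Suc n) + derangements n)"
  by (simp add: algebra_simps)

lemma dquot_Suc_Suc: "dquot (Suc (Suc n)) = of_int (derangements (Suc n) + derangements n)"
proof -
  have "(of_nat (Suc n) :: rat) \<noteq> 0" by (simp only: of_nat_eq_0_iff)
  moreover have "of_nat (Suc (Suc n)) - 1 = (of_nat (Suc n) :: rat)" by simp
  ultimately show ?thesis
    unfolding dquot_def derangements_Suc_Suc of_int_mult of_int_of_nat_eq by simp
qed

lemma dquot_in_Ints: "dquot n \<in> \<int>"
proof (cases n)
  case 0
  then show ?thesis by (simp add: dquot_def)
next
  case (Suc m)
  then show ?thesis
  proof (cases m)
    case 0
    with Suc show ?thesis by (simp add: dquot_def)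
  next
    case (Suc l)
    with \<open>n = Suc m\<close> show ?thesis by (simp only: dquot_Suc_Suc Ints_of_int)
  qed
qed

lemma derangements_add_cong: "int m dvd derangements (n + m) - (-1) ^ m * derangements n"
proof (induction n)
  case 0
  show ?case by (cases m) simp_all
next
  case (Suc n)
  have "derangements (Suc n + m) - (-1) ^ m * derangements (Suc n) =
        int (Suc n) * (derangements (n + m) - (-1) ^ m * derangements n)
        + int m * derangements (n + m)"
    by (simp add: algebra_simps power_add)
  with Suc show ?case by simp
qed

lemma qhat_in_Ints:
  assumes "odd p" "n \<ge> 2"
  shows "qhat p n \<in> \<int>"
proof -
  obtain m where n: "n = Suc (Suc m)"
    using assms(2) by (metis add_2_eq_Suc le_Suc_ex)
  have 1: "int p dvd derangements (Suc m + p) + derangements (Suc m)"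
    using derangements_add_cong[of p "Suc m"] assms(1) by (simp del: derangements.simps)
  have 2: "int p dvd derangements (m + p) + derangements m"
    using derangements_add_cong[of p m] assms(1) by simp
  from dvd_add[OF 1 2] obtain z where z:
    "(derangements (Suc m + p) + derangements (Suc m)) +
     (derangements (m + p) + derangements m) = int p * z" by (auto elim: dvdE)
  have "dquot (n + p) + dquot n =
        of_int (derangements (Suc (m + p)) + derangements (m + p))
        + of_int (derangements (Suc m) + derangements m)"
    by (simp only: n add_Suc dquot_Suc_Suc)
  also have "\<dots> = of_int (int p * z)"
    unfolding z[symmetric] by (simp del: derangements.simps)
  finally have "qhat p n = of_int z"
    using assms(1) by (auto simp: qhat_def)
  then show ?thesis by simp
qed

lemma pval_of_int:
  "pval p (of_int a) = (if a = 0 then Pinf else Fin (int (multiplicity (int p) a)))"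
  by (simp add: pval_def)

lemma derangements_parity: "even (derangements n) \<longleftrightarrow> odd n"
  by (induction n) auto

lemma two_in_primes_A: "2 \<in> primes_A"
proof -
  have "pval 2 (of_nat n - 1) = pval 2 (of_int (derangements n))" for n
  proof -
    consider "n = 0" | "n = 1" | m where "n = Suc (Suc m)"
      by (metis One_nat_def not0_implies_Suc)
    then show ?thesis
    proof cases
      case 1
      have "pval 2 (of_int (-1)) = pval 2 (of_int 1)"
        unfolding pval_of_int by (simp add: not_dvd_imp_multiplicity_0)
      with 1 show ?thesis by simp
    next
      case 2
      then show ?thesis by simp
    next
      case 3
      let ?s = "derangements (Suc m) + derangements m"
      have "odd ?s" using derangements_parity by (metis even_Suc odd_add)
      then have s: "multiplicity 2 ?s = 0" "?s \<noteq> 0"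
        by (simp add: not_dvd_imp_multiplicity_0 del: derangements.simps, metis dvd_0_right)
      have "multiplicity 2 (int (Suc m) * ?s) = multiplicity (2::int) (int (Suc m)) + multiplicity 2 ?s"
        using s(2) by (intro prime_elem_multiplicity_mult_distrib) auto
      with s have "pval 2 (of_int (int (Suc m))) = pval 2 (of_int (int (Suc m) * ?s))"
        unfolding pval_of_int by (simp del: derangements.simps of_nat_Suc)
      moreover have "of_nat n - 1 = (of_int (int (Suc m)) :: rat)" using 3 by simp
      moreover have "derangements n = int (Suc m) * ?s"
        unfolding 3 by (rule derangements_Suc_Suc)
      ultimately show ?thesis by (simp only:)
    qed
  qed
  then show ?thesis by (simp add: primes_A_def)
qed

lemma primes_B_odd: "p \<in> primes_B \<Longrightarrow> odd p"
  using two_in_primes_A primes_dvd_imp_eq[of 2 p] by (auto simp: primes_B_def)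

end

theory Submission
  imports Defs "HOL-Computational_Algebra.Polynomial"
begin

text \<open>
  Iterating \<open>D\<^sub>n = n D\<^sub>n\<^sub>-\<^sub>1 + (-1)\<^sup>n\<close> gives \<open>(-1)\<^sup>n D\<^sub>n = \<Sum>\<^sub>k (-1)\<^sup>k n(n-1)\<dots>(n-k+1)\<close>. Modulo a
  fixed \<open>M\<close> the terms with \<open>k \<ge> M\<close> vanish, so \<open>(-1)\<^sup>n D\<^sub>n\<close>, and with it \<open>(-1)\<^sup>n D\<^sub>n/(n-1)\<close> for
  \<open>n \<ge> 2\<close>, agrees modulo \<open>M\<close> with a polynomial \<open>g\<close> in \<open>n\<close>. For odd \<open>p\<close> and \<open>M = p\<^sup>2\<close>, Taylor's
  formula shows that \<open>(-1)\<^sup>n qhat p n\<close> is \<open>-g'(n)\<close> modulo \<open>p\<close>, so the theorem is Hensel lifting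
  of the roots of \<open>g\<close>.
\<close>

subsection \<open>Polynomial approximation\<close>

text \<open>The factor \<open>int n\<close> vanishes at n = 0, so the truncated \<open>n - 1\<close>
  does no harm there.\<close>

lemma signed_derangements_rec:
  "(-1) ^ n * derangements n = 1 - int n * ((-1) ^ (n - 1) * derangements (n - 1))"
  by (cases n) (simp_all add: algebra_simps flip: power_add)

lemma signed_derangements_falling_expansion:
  "(-1) ^ n * derangements n =
     (\<Sum>k<N. (-1) ^ k * (\<Prod>i<k. int n - int i))
     + (-1) ^ N * (\<Prod>i<N. int n - int i) * ((-1) ^ (n - N) * derangements (n - N))"
proof (induction N)
  case 0
  show ?case by simp
next
  case (Suc N)
  show ?case
  proof (cases "n < N")
    case True
    \<comment> \<open>Once N exceeds n, the factor with i = n annihilates both the new summand and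
      the remainder.\<close>
    then have "(\<Prod>i<N. int n - int i) = 0" by (auto intro!: prod_zero)
    with Suc show ?thesis by simp
  next
    case False
    then have "int (n - N) = int n - int N" by simp
    then have step: "(-1) ^ (n - N) * derangements (n - N) =
        1 - (int n - int N) * ((-1) ^ (n - Suc N) * derangements (n - Suc N))"
      using signed_derangements_rec[of "n - N"] by simp
    show ?thesis
      unfolding Suc unfolding step by (simp add: algebra_simps)
  qed
qed

lemma signed_derangements_poly_approx:
  assumes "M > 0"
  obtains f :: "int poly"
  where "\<And>n. int M dvd (-1) ^ n * derangements n - poly f (int n)"
proof
  fix n
  \<comment> \<open>The factor with i = \<open>n mod M\<close> is divisible by M, so the remainder
    of the expansion after M steps vanishes modulo M. The sum left over is a polynomial that does
    not depend on n.\<close>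
  have "n mod M < M" using assms by simp
  moreover have "int M dvd int n - int (n mod M)" by (simp add: of_nat_mod)
  ultimately have "int M dvd (\<Prod>i<M. int n - int i)"
    by (meson dvd_prod_eqI dvd_trans finite_lessThan lessThan_iff dvd_prodI)
  then show "int M dvd (-1) ^ n * derangements n
      - poly (\<Sum>k<M. smult ((-1) ^ k) (\<Prod>i<k. [:- int i, 1:])) (int n)"
    by (subst signed_derangements_falling_expansion[of n M]) (simp add: poly_sum poly_prod)
qed

lemma diff_dvd_poly_diff:
  fixes f :: "'a::comm_ring_1 poly"
  shows "x - y dvd poly f x - poly f y"
proof (induction f)
  case 0
  show ?case by simp
next
  case (pCons a f)
  have "poly (pCons a f) x - poly (pCons a f) y =
      x * (poly f x - poly f y) + (x - y) * poly f y"
    by (simp add: algebra_simps)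
  with pCons.IH show ?case by simp
qed

text \<open>Induction along Horner's scheme: the remainder for \<open>pCons a g\<close> is x + h
  times the remainder for \<open>g\<close>, plus h^2 g'(x). No factorial has to be divided
  out.\<close>

lemma poly_taylor2:
  fixes g :: "'a::idom poly"
  shows "h\<^sup>2 dvd poly g (x + h) - poly g x - h * poly (pderiv g) x"
proof (induction g)
  case 0
  show ?case by simp
next
  case (pCons a g)
  have "poly (pCons a g) (x + h) - poly (pCons a g) x - h * poly (pderiv (pCons a g)) x =
      (x + h) * (poly g (x + h) - poly g x - h * poly (pderiv g) x) + h\<^sup>2 * poly (pderiv g) x"
    by (simp add: pderiv_pCons algebra_simps power2_eq_square)
  with pCons.IH show ?case by simp
qed

section \<open>Integer forms of the quotients\<close>

definition dq :: "nat \<Rightarrow> int" where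
  "dq n = \<lfloor>dquot n\<rfloor>"

definition qh :: "nat \<Rightarrow> nat \<Rightarrow> int" where
  "qh p n = \<lfloor>qhat p n\<rfloor>"

lemma dquot_eq_dq: "dquot n = of_int (dq n)"
  using dquot_in_Ints by (simp add: dq_def)

lemma qhat_eq_qh: "odd p \<Longrightarrow> n \<ge> 2 \<Longrightarrow> qhat p n = of_int (qh p n)"
  using qhat_in_Ints by (simp add: qh_def)

lemma p_times_qh:
  assumes "odd p" "n \<ge> 2"
  shows "int p * qh p n = dq (n + p) + dq n"
proof -
  have "(of_int (int p * qh p n) :: rat) = of_int (dq (n + p) + dq n)"
    using odd_pos[OF assms(1)] qhat_eq_qh[OF assms] by (simp add: qhat_def dquot_eq_dq field_simps)
  then show ?thesis by (simp only: of_int_eq_iff)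
qed

lemma zdvd_of_int [simp]: "zdvd m (of_int z) \<longleftrightarrow> int m dvd z"
  by (simp add: zdvd_def)

text \<open>Since D_n/(n-1) = D_(n-1) + D_(n-2) for n >= 2, one can take g(x) = f(x-2) - f(x-1).
  This avoids dividing by n - 1, which need not be a unit modulo M.\<close>

lemma signed_dq_poly_approx:
  assumes "M > 0"
  obtains g :: "int poly"
  where "\<And>n. n \<ge> 2 \<Longrightarrow> int M dvd (-1) ^ n * dq n - poly g (int n)"
proof -
  obtain f where f: "\<And>n. int M dvd (-1) ^ n * derangements n - poly f (int n)"
    using signed_derangements_poly_approx[OF assms] by blast
  show thesis
  proof
    fix n :: nat
    assume "n \<ge> 2"
    then obtain m where n: "n = Suc (Suc m)" by (metis add_2_eq_Suc le_Suc_ex)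
    have "dq n = derangements (Suc m) + derangements m"
      unfolding n dq_def dquot_Suc_Suc by (rule floor_of_int)
    then have "(-1) ^ n * dq n - poly (f \<circ>\<^sub>p [:-2, 1:] - f \<circ>\<^sub>p [:-1, 1:]) (int n) =
        ((-1) ^ m * derangements m - poly f (int m))
        - ((-1) ^ Suc m * derangements (Suc m) - poly f (int (Suc m)))"
      by (simp add: n poly_pcompose algebra_simps del: derangements.simps)
    with dvd_diff[OF f[of m] f[of "Suc m"]]
    show "int M dvd (-1) ^ n * dq n - poly (f \<circ>\<^sub>p [:-2, 1:] - f \<circ>\<^sub>p [:-1, 1:]) (int n)"
      by (simp only:)
  qed
qed

text \<open>As p is odd, the signs at n and n + p are opposite, so the sum in \<open>qhat\<close>
  is, modulo p^2 and up to sign, the difference g(n+p) - g(n). Taylor's formula turns this into p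
  g'(n), and p cancels.\<close>

lemma qh_derivative:
  assumes "odd p" "k > 0" "n \<ge> 2"
    and g: "\<And>n. n \<ge> 2 \<Longrightarrow> int (p ^ (k + 1)) dvd (-1) ^ n * dq n - poly g (int n)"
  shows "int p dvd (-1) ^ n * qh p n + poly (pderiv g) (int n)"
proof -
  \<comment> \<open>Because k > 0, an approximation \<open>g\<close> modulo p^(k+1) is also valid
    modulo p^2.\<close>
  have "(int p)\<^sup>2 dvd int (p ^ (k + 1))"
    unfolding of_nat_power using assms(2) by (intro le_imp_power_dvd) simp
  then have g2: "(int p)\<^sup>2 dvd (-1) ^ n * dq n - poly g (int n)" if "n \<ge> 2" for n
    using g[OF that] dvd_trans by blast
  have "(int p)\<^sup>2 dvd ((-1) ^ n * dq n - poly g (int n))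
      - ((-1) ^ (n + p) * dq (n + p) - poly g (int (n + p)))
      - (poly g (int n + int p) - poly g (int n) - int p * poly (pderiv g) (int n))"
    using assms(3) by (intro dvd_diff g2 poly_taylor2) auto
  also have "\<dots> = (-1) ^ n * (dq (n + p) + dq n) + int p * poly (pderiv g) (int n)"
    using assms(1) by (simp add: power_add algebra_simps)
  also have "\<dots> = int p * ((-1) ^ n * qh p n + poly (pderiv g) (int n))"
    unfolding p_times_qh[OF assms(1,3), symmetric] by (simp add: algebra_simps)
  finally show ?thesis
    using assms(1) by (auto simp: power2_eq_square)
qed

text \<open>Put h = n' - n. The Taylor remainder is divisible by p^(2k), and 2k >= k + 1. In the
  linear term h already carries p^k, so g'(n) matters only modulo p and \<open>qh_derivative\<close>
  replaces it.\<close>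

lemma signed_dq_expansion:
  assumes "odd p" "k > 0" "n \<ge> 2" "n' \<ge> 2" "int (p ^ k) dvd int n' - int n"
  shows "int (p ^ (k + 1)) dvd (-1) ^ n' * dq n' - (-1) ^ n * (dq n - (int n' - int n) * qh p n)"
proof -
  have "p ^ (k + 1) > 0" using assms(1) by (auto intro: Nat.gr0I)
  then obtain g where g: "\<And>n. n \<ge> 2 \<Longrightarrow> int (p ^ (k + 1)) dvd (-1) ^ n * dq n - poly g (int n)"
    using signed_dq_poly_approx by blast
  let ?h = "int n' - int n"
  have "int (p ^ (k + 1)) dvd int (p ^ (k + k))"
    unfolding of_nat_power using assms(2) by (intro le_imp_power_dvd) simp
  also have "\<dots> = int (p ^ k) * int (p ^ k)" by (simp add: power_add)
  also have "\<dots> dvd ?h\<^sup>2"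
    using assms(5) by (simp add: power2_eq_square mult_dvd_mono del: of_nat_power)
  also have "\<dots> dvd poly g (int n + ?h) - poly g (int n) - ?h * poly (pderiv g) (int n)"
    by (rule poly_taylor2)
  finally have 1: "int (p ^ (k + 1)) dvd
      poly g (int n') - poly g (int n) - ?h * poly (pderiv g) (int n)" by simp
  have 2: "int (p ^ (k + 1)) dvd ?h * ((-1) ^ n * qh p n + poly (pderiv g) (int n))"
    using mult_dvd_mono[OF assms(5) qh_derivative[OF assms(1-3) g]] by (simp add: mult.commute)
  show ?thesis
    using dvd_add[OF dvd_diff[OF dvd_add[OF 1 g[OF assms(4)]] g[OF assms(3)]] 2]
    by (simp add: algebra_simps)
qed

section \<open>Divisibility along residue classes\<close>

lemma dvd_signed_diff_iff:
  fixes a b d :: int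
  assumes "d dvd (-1) ^ m * a - (-1) ^ n * b"
  shows "d dvd a \<longleftrightarrow> d dvd b"
proof -
  have "d dvd (-1) ^ m * a \<longleftrightarrow> d dvd (-1) ^ n * b"
    using assms by (metis dvd_diff_commute dvd_diffD dvd_diff_right_iff dvd_diff_left_iff)
  then show ?thesis by (cases "even m"; cases "even n") auto
qed

text \<open>Signs are units, so lifting a root from p^k to p^(k+1) becomes a linear congruence for
  n' - n with slope \<open>qh p n\<close>. All cases of the theorem rest on this criterion.\<close>

lemma dvd_dq_lift_iff:
  assumes "odd p" "k > 0" "n \<ge> 2" "n' \<ge> 2" "int (p ^ k) dvd int n' - int n"
  shows "int (p ^ (k + 1)) dvd dq n' \<longleftrightarrow> int (p ^ (k + 1)) dvd dq n - (int n' - int n) * qh p n"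
  by (rule dvd_signed_diff_iff[OF signed_dq_expansion[OF assms]])

lemma dvd_dq_cong:
  assumes "odd p" "k > 0" "n \<ge> 2" "n' \<ge> 2" "int (p ^ k) dvd int n' - int n"
  shows "int (p ^ k) dvd dq n' \<longleftrightarrow> int (p ^ k) dvd dq n"
proof -
  have "int (p ^ k) dvd int (p ^ (k + 1))" by simp
  then have "int (p ^ k) dvd (-1) ^ n' * dq n' - (-1) ^ n * (dq n - (int n' - int n) * qh p n)"
    using signed_dq_expansion[OF assms] dvd_trans by blast
  from dvd_signed_diff_iff[OF this] have
    "int (p ^ k) dvd dq n' \<longleftrightarrow> int (p ^ k) dvd dq n - (int n' - int n) * qh p n" .
  with assms(5) show ?thesis by (simp add: dvd_diff_left_iff del: of_nat_power)
qed

text \<open>Both signed terms are values of -g' modulo p, at arguments congruent modulo p. The signs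
  must stay because a class modulo the odd p does not fix the parity of n.\<close>

lemma qh_cong:
  assumes "odd p" "n \<ge> 2" "n' \<ge> 2" "int p dvd int n' - int n"
  shows "int p dvd (-1) ^ n' * qh p n' - (-1) ^ n * qh p n"
proof -
  have "p ^ (1 + 1) > 0" using assms(1) by (auto intro: Nat.gr0I)
  then obtain g where g: "\<And>n. n \<ge> 2 \<Longrightarrow> int (p ^ (1 + 1)) dvd (-1) ^ n * dq n - poly g (int n)"
    using signed_dq_poly_approx by blast
  have "int p dvd poly (pderiv g) (int n') - poly (pderiv g) (int n)"
    using assms(4) diff_dvd_poly_diff by (rule dvd_trans)
  from dvd_diff[OF dvd_diff[OF qh_derivative[OF assms(1) _ assms(3) g]
      qh_derivative[OF assms(1) _ assms(2) g]] this]
  show ?thesis by (simp add: algebra_simps)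
qed

subsection \<open>Lifting\<close>

text \<open>Residue classes are given by integers, while the quotients are taken at naturals n >= 2;
  adding 2M to the least residue supplies one.\<close>

lemma ex_nat_ge2_cong:
  assumes "M > 0"
  obtains n :: nat where "n \<ge> 2" "[int n = a] (mod int M)"
proof
  have "a mod int M \<ge> 0" using assms by simp
  then have *: "int (nat (a mod int M) + 2 * M) = a mod int M + 2 * int M" by simp
  show "nat (a mod int M) + 2 * M \<ge> 2" using assms by simp
  show "[int (nat (a mod int M) + 2 * M) = a] (mod int M)"
    unfolding * by (simp add: cong_def)
qed

section \<open>Valuations and rational congruences\<close>

lemma pval_ge_of_int_iff:
  assumes "prime p"
  shows "pval p (of_int z) \<ge> Fin (int l) \<longleftrightarrow> int (p ^ l) dvd z"
proof (cases "z = 0")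
  case False
  moreover have "\<not> is_unit (int p)" using assms by auto
  ultimately show ?thesis by (simp add: pval_of_int power_dvd_iff_le_multiplicity)
qed (simp add: pval_def)

text \<open>\<open>pval\<close> reads off the reduced fraction a/b. From a q = b x and coprimality,
  b divides q, so p does not divide b; and p^j, being coprime to q, divides a.\<close>

lemma pval_divide_ge:
  assumes "prime p" "\<not> int p dvd q" "int (p ^ j) dvd x"
  shows "pval p (of_int x / of_int q) \<ge> Fin (int j)"
proof (cases "x = 0")
  case True
  then show ?thesis by (simp add: pval_def)
next
  case False
  have q: "q \<noteq> 0" using assms(2) by auto
  obtain a b where ab: "quotient_of (of_int x / of_int q) = (a, b)" by fastforce
  have b: "b > 0" using quotient_of_denom_pos[OF ab] .
  have "coprime a b" using quotient_of_coprime[OF ab] .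
  have "(of_int x / of_int q :: rat) = of_int a / of_int b" using quotient_of_div[OF ab] .
  then have "(of_int (a * q) :: rat) = of_int (b * x)"
    using b q by (simp add: field_simps)
  then have eq: "a * q = b * x" by (simp only: of_int_eq_iff)
  have "b dvd a * q" by (simp add: eq)
  with \<open>coprime a b\<close> have "b dvd q" by (simp add: coprime_commute coprime_dvd_mult_right_iff)
  with assms(2) have pb: "\<not> int p dvd b" using dvd_trans by blast
  have "coprime (int (p ^ j)) q"
    using assms(1,2) by (simp add: prime_imp_coprime)
  moreover have "int (p ^ j) dvd a * q" unfolding eq using assms(3) by (rule dvd_mult)
  ultimately have "int (p ^ j) dvd a" by (simp add: coprime_dvd_mult_left_iff)
  moreover have "a \<noteq> 0" using eq b False by auto
  moreover have "\<not> is_unit (int p)" using assms(1) by auto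
  ultimately have "j \<le> multiplicity (int p) a" by (simp add: power_dvd_iff_le_multiplicity)
  with pb False q show ?thesis by (simp add: pval_def ab not_dvd_imp_multiplicity_0)
qed

text \<open>The difference of the two sides is ((a-m) q - D_m/(m-1))/q, with q prime to p. The
  number q is left general so that a slope at another point, with a sign, can be inserted.\<close>

lemma rat_cong_newton_step:
  assumes "prime p" "\<not> int p dvd q" "int (p ^ j) dvd (a - int m) * q - dq m"
  shows "rat_cong p j (of_int a) (of_nat m + of_int (derangements m) / ((of_nat m - 1) * of_int q))"
proof -
  have "q \<noteq> 0" using assms(2) by auto
  have "of_int a - (of_nat m + of_int (derangements m) / ((of_nat m - 1) * of_int q)) =
      of_int a - of_nat m - dquot m / of_int q"
    by (simp add: dquot_def)
  also have "\<dots> = of_int ((a - int m) * q - dq m) / of_int q"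
    using \<open>q \<noteq> 0\<close> by (simp add: dquot_eq_dq field_simps)
  finally show ?thesis
    unfolding rat_cong_def using pval_divide_ge[OF assms] by simp
qed

section \<open>Linear congruences modulo prime powers\<close>

lemma lift_exists:
  assumes "prime p" "\<not> int p dvd q" "int (p ^ k) dvd d"
  obtains a where "int (p ^ k) dvd a - m" "int (p ^ (k + 1)) dvd d - (a - m) * q"
proof -
  obtain e where d: "d = int (p ^ k) * e" using assms(3) by blast
  have "coprime q (int p)"
    using prime_imp_coprime[of "int p" q] assms(1,2) by (simp add: coprime_commute)
  then obtain u where "[q * u = 1] (mod int p)"
    using cong_solve_coprime_int by blast
  then have "int p dvd q * u - 1" by (simp add: cong_iff_dvd_diff)
  then have "int p dvd (q * u - 1) * (- e)" by (rule dvd_mult2)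
  then have "int p dvd e - e * u * q" by (simp add: algebra_simps)
  then have "int (p ^ k) * int p dvd int (p ^ k) * (e - e * u * q)" by simp
  \<comment> \<open>The solution is m + p^k e u, where u inverts q modulo p.\<close>
  then have "int (p ^ (k + 1)) dvd d - (m + int (p ^ k) * (e * u) - m) * q"
    by (simp add: d algebra_simps)
  moreover have "int (p ^ k) dvd (m + int (p ^ k) * (e * u)) - m" by simp
  ultimately show thesis using that by blast
qed

lemma lift_unique:
  assumes "prime p" "\<not> int p dvd q" "int (p ^ j) dvd d - x * q" "int (p ^ j) dvd d - y * q"
  shows "int (p ^ j) dvd x - y"
proof -
  have "int (p ^ j) dvd (x - y) * q"
    using dvd_diff[OF assms(4,3)] by (simp add: algebra_simps)
  moreover have "coprime (int (p ^ j)) q"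
    using assms(1,2) by (simp add: prime_imp_coprime)
  ultimately show ?thesis by (simp add: coprime_dvd_mult_left_iff)
qed

text \<open>The condition on all n in the class of a collapses to one congruence: replacing n by a
  changes the linear expression of \<open>dvd_dq_lift_iff\<close> by a multiple of p^(k+1).\<close>

lemma lift_dvd_iff:
  assumes "odd p" "k > 0" "m \<ge> 2"
  shows "lift_dvd p k m a \<longleftrightarrow>
    int (p ^ k) dvd a - int m \<and> int (p ^ (k + 1)) dvd dq m - (a - int m) * qh p m"
proof -
  have *: "int (p ^ (k + 1)) dvd dq n \<longleftrightarrow> int (p ^ (k + 1)) dvd dq m - (a - int m) * qh p m"
    if "int (p ^ k) dvd a - int m" "n \<ge> 2" "[int n = a] (mod int (p ^ (k + 1)))" for n
  proof -
    have na: "int (p ^ (k + 1)) dvd int n - a" using that(3) by (simp add: cong_iff_dvd_diff)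
    moreover have "int (p ^ k) dvd int (p ^ (k + 1))" by simp
    ultimately have "int (p ^ k) dvd int n - a" using dvd_trans by blast
    from dvd_add[OF this that(1)] have "int (p ^ k) dvd int n - int m" by simp
    from dvd_dq_lift_iff[OF assms that(2) this]
    have "int (p ^ (k + 1)) dvd dq n \<longleftrightarrow> int (p ^ (k + 1)) dvd dq m - (int n - int m) * qh p m" .
    moreover have "dq m - (a - int m) * qh p m =
        dq m - (int n - int m) * qh p m + (int n - a) * qh p m" by (simp add: algebra_simps)
    ultimately show ?thesis by (simp only: dvd_add_left_iff[OF dvd_mult2[OF na]])
  qed
  \<comment> \<open>Some n >= 2 lies in the class of a, so the universal condition is not vacuous
    and yields the congruence on a.\<close>
  have "p ^ (k + 1) > 0" using assms(1) by (auto intro: Nat.gr0I)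
  then obtain n0 where "n0 \<ge> 2" "[int n0 = a] (mod int (p ^ (k + 1)))"
    using ex_nat_ge2_cong by blast
  with * show ?thesis
    unfolding lift_dvd_def dquot_eq_dq zdvd_of_int cong_iff_dvd_diff by blast
qed

text \<open>By \<open>dvd_dq_cong\<close> a single witness decides the whole class.\<close>

lemma lift_val_iff:
  assumes "prime p" "odd p" "l > 0"
  shows "lift_val p m l a \<longleftrightarrow>
    (\<exists>n\<ge>2. int (p ^ l) dvd int n - a \<and> int p dvd int n - int m \<and> int (p ^ l) dvd dq n)"
    (is "_ \<longleftrightarrow> ?R")
proof -
  have pl: "int p dvd int (p ^ l)" using assms(3) by simp
  have lv: "lift_val p m l a \<longleftrightarrow> int p dvd a - int m \<and>
      (\<forall>n\<ge>2. int (p ^ l) dvd int n - a \<longrightarrow> int (p ^ l) dvd dq n)"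
    unfolding lift_val_def dquot_eq_dq pval_ge_of_int_iff[OF assms(1)] cong_iff_dvd_diff by blast
  show ?thesis
  proof
    assume L: "lift_val p m l a"
    have "p ^ l > 0" using assms(1) by (simp add: prime_gt_0_nat)
    then obtain n where n: "n \<ge> 2" "int (p ^ l) dvd int n - a"
      using ex_nat_ge2_cong[of "p ^ l" a] unfolding cong_iff_dvd_diff by blast
    have "int p dvd (int n - a) + (a - int m)"
      using dvd_add[OF dvd_trans[OF pl n(2)]] L lv by blast
    with n L lv show ?R by auto
  next
    assume ?R
    then obtain n where n: "n \<ge> 2" "int (p ^ l) dvd int n - a" "int p dvd int n - int m"
      "int (p ^ l) dvd dq n" by blast
    have "int p dvd (int n - int m) - (int n - a)"
      using dvd_diff[OF n(3) dvd_trans[OF pl n(2)]] .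
    then have "int p dvd a - int m" by simp
    moreover have "int (p ^ l) dvd dq n'" if "n' \<ge> 2" "int (p ^ l) dvd int n' - a" for n'
    proof -
      have "int (p ^ l) dvd int n' - int n" using dvd_diff[OF that(2) n(2)] by simp
      with dvd_dq_cong[OF assms(2,3) n(1) that(1)] n(4) show ?thesis by blast
    qed
    ultimately show "lift_val p m l a" using lv by blast
  qed
qed

section \<open>Roots modulo all powers of p\<close>

lemma not_dvd_qh_cong:
  assumes "odd p" "m \<ge> 2" "n \<ge> 2" "int p dvd int n - int m" "\<not> int p dvd qh p m"
  shows "\<not> int p dvd qh p n"
  using dvd_signed_diff_iff[OF qh_cong[OF assms(1-4)]] assms(5) by blast

text \<open>Hensel induction: each root is lifted from the preceding root n, not from m, and
  \<open>not_dvd_qh_cong\<close> keeps the slope at n a unit modulo p.\<close>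

lemma root_mod_prime_power_exists:
  assumes "prime p" "odd p" "m \<ge> 2" "int p dvd dq m" "\<not> int p dvd qh p m" "l > 0"
  shows "\<exists>n\<ge>2. int p dvd int n - int m \<and> int (p ^ l) dvd dq n"
  using \<open>l > 0\<close>
proof (induction l rule: nat_induct_non_zero)
  case 1
  with assms(3,4) show ?case by auto
next
  case (Suc l)
  then obtain n where n: "n \<ge> 2" "int p dvd int n - int m" "int (p ^ l) dvd dq n" by blast
  have "\<not> int p dvd qh p n" using not_dvd_qh_cong assms n by blast
  from lift_exists[OF assms(1) this n(3)] obtain a where
    a: "int (p ^ l) dvd a - int n" "int (p ^ (l + 1)) dvd dq n - (a - int n) * qh p n" by blast
  then have L: "lift_dvd p l n a" using lift_dvd_iff[OF assms(2) _ n(1)] Suc by blast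
  have "p ^ (l + 1) > 0" using assms(1) by (simp add: prime_gt_0_nat)
  then obtain n' where n': "n' \<ge> 2" "[int n' = a] (mod int (p ^ (l + 1)))"
    using ex_nat_ge2_cong by blast
  with L have "int (p ^ (l + 1)) dvd dq n'" by (simp add: lift_dvd_def dquot_eq_dq)
  moreover have "int p dvd int n' - int m"
  proof -
    have "int p dvd int (p ^ (l + 1))" "int p dvd int (p ^ l)" using Suc by auto
    then have "int p dvd int n' - a" "int p dvd a - int n"
      using n'(2) a(1) dvd_trans unfolding cong_iff_dvd_diff by blast+
    from dvd_add[OF dvd_add[OF this] n(2)] show ?thesis by simp
  qed
  ultimately show ?case using n'(1) by auto
qed

text \<open>Roots modulo p^(l+1) are roots modulo p^l, so by induction n and n' agree modulo p^l.
  Then the linear congruence at n applies, and its slope is a unit modulo p.\<close>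

lemma root_mod_prime_power_unique:
  assumes "prime p" "odd p" "m \<ge> 2" "\<not> int p dvd qh p m" "l > 0"
    and "n \<ge> 2" "int p dvd int n - int m" "int (p ^ l) dvd dq n"
    and "n' \<ge> 2" "int p dvd int n' - int m" "int (p ^ l) dvd dq n'"
  shows "int (p ^ l) dvd int n' - int n"
  using \<open>l > 0\<close> assms(8,11)
proof (induction l rule: nat_induct_non_zero)
  case 1
  show ?case using dvd_diff[OF assms(10,7)] by simp
next
  case (Suc l)
  have "int (p ^ l) dvd int (p ^ Suc l)" by simp
  then have "int (p ^ l) dvd int n' - int n"
    using Suc.IH Suc.prems dvd_trans by blast
  then have "int (p ^ (l + 1)) dvd dq n - (int n' - int n) * qh p n"
    using dvd_dq_lift_iff[OF assms(2) _ assms(6,9)] Suc by simp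
  \<comment> \<open>The shift 0 belongs to n itself; \<open>lift_unique\<close> compares it with the
    shift n' - n.\<close>
  moreover have "int (p ^ (l + 1)) dvd dq n - 0 * qh p n" using Suc.prems by simp
  moreover have "\<not> int p dvd qh p n" using not_dvd_qh_cong assms by blast
  ultimately have "int (p ^ (l + 1)) dvd (int n' - int n) - 0"
    using lift_unique[OF assms(1)] by blast
  then show ?case by simp
qed

lemma lift_val_ex1:
  assumes "prime p" "odd p" "m \<ge> 2" "int p dvd dq m" "\<not> int p dvd qh p m" "l > 0"
  shows "ex1_mod (p ^ l) (lift_val p m l)"
  unfolding ex1_mod_def
proof (intro conjI allI impI)
  obtain n where "n \<ge> 2" "int p dvd int n - int m" "int (p ^ l) dvd dq n"
    using root_mod_prime_power_exists[OF assms] by blast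
  then have "lift_val p m l (int n)"
    unfolding lift_val_iff[OF assms(1,2,6)] by auto
  then show "\<exists>a. lift_val p m l a" ..
next
  fix a b
  assume "lift_val p m l a" "lift_val p m l b"
  then obtain n n' where n: "n \<ge> 2" "int (p ^ l) dvd int n - a" "int p dvd int n - int m"
      "int (p ^ l) dvd dq n"
    and n': "n' \<ge> 2" "int (p ^ l) dvd int n' - b" "int p dvd int n' - int m"
      "int (p ^ l) dvd dq n'"
    unfolding lift_val_iff[OF assms(1,2,6)] by blast
  have "int (p ^ l) dvd int n' - int n"
    using root_mod_prime_power_unique[OF assms(1,2,3,5,6)] n n' by blast
  from dvd_diff[OF dvd_diff[OF n'(2) this] n(2)] have "int (p ^ l) dvd a - b"
    by (simp add: algebra_simps)
  then show "[a = b] (mod int (p ^ l))" by (simp add: cong_iff_dvd_diff)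
qed

text \<open>The slope at m may be replaced by the one at n1: they agree modulo p up to the parity
  sign, and the error is multiplied by a number divisible by p^(l-1).\<close>

lemma lift_val_newton_step:
  assumes "prime p" "odd p" "n1 \<ge> 2" "\<not> int p dvd qh p n1" "l > 1" "m \<ge> 2"
    and "lift_val p n1 (l - 1) (int m)" "lift_val p n1 l a"
  shows "int (p ^ l) dvd (a - int m) * ((-1) ^ (m + n1) * qh p n1) - dq m"
proof -
  obtain k where l: "l = k + 1" and k: "k > 0" using assms(5) by (metis less_imp_add_positive add.commute)
  have m: "int p dvd int m - int n1" "int (p ^ k) dvd dq m"
    using assms(1,6,7)
    by (auto simp: lift_val_def l cong_iff_dvd_diff dquot_eq_dq pval_ge_of_int_iff)
  obtain n where n: "n \<ge> 2" "int (p ^ l) dvd int n - a" "int p dvd int n - int n1"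
      "int (p ^ l) dvd dq n"
    using assms(5,8) lift_val_iff[OF assms(1,2)] by (metis zero_less_one less_trans)
  have kl: "int (p ^ k) dvd int (p ^ l)" by (simp add: l)
  \<comment> \<open>Both n and m are roots modulo p^(l-1) in the class of n1 modulo p, so uniqueness
    applies.\<close>
  have nm: "int (p ^ k) dvd int n - int m"
    using root_mod_prime_power_unique[OF assms(1-4) k assms(6) m n(1,3)] dvd_trans[OF kl n(4)]
    by blast
  have 1: "int (p ^ l) dvd dq m - (int n - int m) * qh p m"
    using dvd_dq_lift_iff[OF assms(2) k assms(6) n(1) nm] n(4) by (simp add: l)
  \<comment> \<open>The factor (-1)^m moves both signs onto the slope at n1.\<close>
  have "int p dvd (-1) ^ m * ((-1) ^ m * qh p m - (-1) ^ n1 * qh p n1)"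
    using qh_cong[OF assms(2,3,6) m(1)] by (rule dvd_mult)
  then have "int p dvd qh p m - (-1) ^ (m + n1) * qh p n1"
    by (simp add: algebra_simps power_add flip: power_mult_distrib)
  from mult_dvd_mono[OF nm this]
  have 2: "int (p ^ l) dvd (int n - int m) * (qh p m - (-1) ^ (m + n1) * qh p n1)"
    by (simp add: l mult.commute)
  have 3: "int (p ^ l) dvd (int n - a) * ((-1) ^ (m + n1) * qh p n1)"
    using n(2) by (rule dvd_mult2)
  have "int (p ^ l) dvd - (dq m - (int n - int m) * qh p m)
      - (int n - int m) * (qh p m - (-1) ^ (m + n1) * qh p n1)
      - (int n - a) * ((-1) ^ (m + n1) * qh p n1)"
    using 1 2 3 by (intro dvd_diff) (simp_all only: dvd_minus_iff)
  also have "\<dots> = (a - int m) * ((-1) ^ (m + n1) * qh p n1) - dq m"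
    by (simp add: algebra_simps)
  finally show ?thesis .
qed

section \<open>Lifting and Newton steps for D_n/(n-1)\<close>

theorem theorem6:
  fixes p k nk :: nat
  assumes "p \<in> primes_B" and "k > 0" and "nk \<ge> 2" and "zdvd (p ^ k) (dquot nk)"
  shows
    "(\<not> zdvd p (qhat p nk) \<longrightarrow>
        ex1_mod (p ^ (k + 1)) (lift_dvd p k nk) \<and>
        (\<forall>a. lift_dvd p k nk a \<longrightarrow>
           rat_cong p (k + 1) (of_int a)
             (of_nat nk + of_int (derangements nk) / ((of_nat nk - 1) * qhat p nk)))) \<and>
     (zdvd p (qhat p nk) \<and> zdvd (p ^ (k + 1)) (dquot nk) \<longrightarrow>
        (\<forall>n::nat. [n = nk] (mod p ^ k) \<and> n \<ge> 2 \<longrightarrow> zdvd (p ^ (k + 1)) (dquot n))) \<and>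
     (zdvd p (qhat p nk) \<and> \<not> zdvd (p ^ (k + 1)) (dquot nk) \<longrightarrow>
        (\<forall>n::nat. [n = nk] (mod p ^ k) \<and> n \<ge> 2 \<longrightarrow> \<not> zdvd (p ^ (k + 1)) (dquot n))) \<and>
     (k = 1 \<and> \<not> zdvd (p ^ 2) (dquot (nk + p) + dquot nk) \<longrightarrow>
        (\<forall>l>0. ex1_mod (p ^ l) (lift_val p nk l)) \<and>
        (\<forall>l>1. \<forall>m::nat. \<forall>a. m \<ge> 2 \<and> lift_val p nk (l - 1) (int m) \<and> lift_val p nk l a \<longrightarrow>
           (even m = even nk \<longrightarrow>
              rat_cong p l (of_int a)
                (of_nat m + of_int (derangements m) / ((of_nat m - 1) * qhat p nk))) \<and>
           (even m \<noteq> even nk \<longrightarrow>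
              rat_cong p l (of_int a)
                (of_nat m - of_int (derangements m) / ((of_nat m - 1) * qhat p nk)))))"
proof -
  have p: "prime p" "odd p" using assms(1) primes_B_odd by (auto simp: primes_B_def)
  have q: "qhat p nk = of_int (qh p nk)" using qhat_eq_qh p(2) assms(3) .
  have dk: "int (p ^ k) dvd dq nk" using assms(4) by (simp add: dquot_eq_dq)
  have ld: "lift_dvd p k nk a \<longleftrightarrow>
      int (p ^ k) dvd a - int nk \<and> int (p ^ (k + 1)) dvd dq nk - (a - int nk) * qh p nk" for a
    using lift_dvd_iff[OF p(2) assms(2,3)] .
  have part1: "ex1_mod (p ^ (k + 1)) (lift_dvd p k nk)"
    "\<And>a. lift_dvd p k nk a \<Longrightarrow> rat_cong p (k + 1) (of_int a)
        (of_nat nk + of_int (derangements nk) / ((of_nat nk - 1) * qhat p nk))"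
    if nq: "\<not> zdvd p (qhat p nk)"
  proof -
    have nq': "\<not> int p dvd qh p nk" using nq q by simp
    show "ex1_mod (p ^ (k + 1)) (lift_dvd p k nk)"
      unfolding ex1_mod_def
    proof (intro conjI allI impI)
      show "\<exists>a. lift_dvd p k nk a"
        using lift_exists[OF p(1) nq' dk] ld by metis
      fix a b
      assume "lift_dvd p k nk a" "lift_dvd p k nk b"
      then have "int (p ^ (k + 1)) dvd (a - int nk) - (b - int nk)"
        using ld lift_unique[OF p(1) nq'] by blast
      then show "[a = b] (mod int (p ^ (k + 1)))" by (simp add: cong_iff_dvd_diff)
    qed
    fix a
    assume "lift_dvd p k nk a"
    then have "int (p ^ (k + 1)) dvd (a - int nk) * qh p nk - dq nk"
      using ld dvd_diff_commute by blast
    from rat_cong_newton_step[OF p(1) nq' this]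
    show "rat_cong p (k + 1) (of_int a)
        (of_nat nk + of_int (derangements nk) / ((of_nat nk - 1) * qhat p nk))"
      unfolding q .
  qed
  \<comment> \<open>When p divides the slope, the linear term vanishes modulo p^(k+1), so
    divisibility is constant on the class modulo p^k. The two directions give (2) and (3).\<close>
  have part23: "zdvd (p ^ (k + 1)) (dquot n) \<longleftrightarrow> zdvd (p ^ (k + 1)) (dquot nk)"
    if "zdvd p (qhat p nk)" "[n = nk] (mod p ^ k)" "n \<ge> 2" for n
  proof -
    have d: "int (p ^ k) dvd int n - int nk"
      using that(2) cong_int_iff cong_iff_dvd_diff by blast
    moreover have "int p dvd qh p nk" using that(1) q by simp
    ultimately have "int (p ^ k) * int p dvd (int n - int nk) * qh p nk"
      by (rule mult_dvd_mono)
    then have "int (p ^ (k + 1)) dvd (int n - int nk) * qh p nk" by (simp add: mult.commute)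
    then show ?thesis
      using dvd_dq_lift_iff[OF p(2) assms(2,3) that(3) d]
      by (simp add: dquot_eq_dq dvd_diff_left_iff del: of_nat_power power_Suc)
  qed
  have part4: "ex1_mod (p ^ l) (lift_val p nk l)" if "\<not> int p dvd qh p nk" "k = 1" "l > 0" for l
    using lift_val_ex1[OF p assms(3) _ that(1,3)] dk that(2) by simp
  have part5:
    "even m = even nk \<Longrightarrow> rat_cong p l (of_int a)
      (of_nat m + of_int (derangements m) / ((of_nat m - 1) * qhat p nk))"
    "even m \<noteq> even nk \<Longrightarrow> rat_cong p l (of_int a)
      (of_nat m - of_int (derangements m) / ((of_nat m - 1) * qhat p nk))"
    if nq: "\<not> int p dvd qh p nk"
      and h: "l > 1" "m \<ge> 2" "lift_val p nk (l - 1) (int m)" "lift_val p nk l a" for l m a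
  proof -
    \<comment> \<open>This is the slope at \<open>nk\<close> or its negative, according to parity,
      whence the two formulas.\<close>
    let ?q = "(-1) ^ (m + nk) * qh p nk"
    have "\<not> int p dvd ?q" using nq by (cases "even (m + nk)") auto
    from rat_cong_newton_step[OF p(1) this lift_val_newton_step[OF p assms(3) nq h]]
    have r: "rat_cong p l (of_int a)
      (of_nat m + of_int (derangements m) / ((of_nat m - 1) * of_int ?q))" .
    {
      assume "even m = even nk"
      then have "?q = qh p nk" by auto
      with r show "rat_cong p l (of_int a)
          (of_nat m + of_int (derangements m) / ((of_nat m - 1) * qhat p nk))"
        by (simp only: q)
    next
      assume "even m \<noteq> even nk"
      then have "?q = - qh p nk" by auto
      with r show "rat_cong p l (of_int a)
          (of_nat m - of_int (derangements m) / ((of_nat m - 1) * qhat p nk))"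
        by (simp only: q of_int_minus mult_minus_right divide_minus_right add_uminus_conv_diff)
    }
  qed
  \<comment> \<open>The sum in the hypothesis is p times the slope.\<close>
  have "\<not> int p dvd qh p nk" if "\<not> zdvd (p ^ 2) (dquot (nk + p) + dquot nk)"
  proof
    assume "int p dvd qh p nk"
    then have "int (p ^ 2) dvd dq (nk + p) + dq nk"
      unfolding p_times_qh[OF p(2) assms(3), symmetric] by (simp add: power2_eq_square)
    with that show False by (simp add: dquot_eq_dq flip: of_int_add)
  qed
  with part1 part23 part4 part5 show ?thesis by blast
qed

end
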